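(* Let $f:\mathbb{R}^4\to\mathbb{R}$, $(v,\tau,u,t)\mapsto f(v,\tau,u,t)$, satisfy: (A1) $f$ is bounded and Lipschitz continuous; (A2) $f(v+l,\tau+k,u,t)=f(v,\tau,u,t)$ for all $(v,\tau,u,t)\in\mathbb{R}^4$ and all $(l,k)\in\mathbb{Z}^2$; (A3) for every $(v,\tau,t)\in\mathbb{R}^3$ the function $u\mapsto f(v,\tau,u,t)$ is non-increasing. Then for every fixed $(u,t)\in\mathbb{R}^2$ there exists $\lambda\in\mathbb{R}$ such that for any $u_0\in\mathbb{R}$ the solution $v\in C^1([0,\infty);\mathbb{R})$ of $$v_\tau=f(v,\tau,u,t)\ (\tau>0),\qquad v(0)=u_0,$$ satisfies $\dfrac{v(\tau)}{\tau}\to\lambda$ as $\tau\to\infty$. Moreover, setting $\overline f(u,t)=\lambda$, the function $\overline f:\mathbb{R}^2\to\mathbb{R}$ is continuous, and for any $t\ge 0$ the map $u\mapsto\overline f(u,t)$ is non-increasing.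
   Context: In the ordinary differential equation for $v$ the parameters $u$ and $t$ are frozen constants; the independent variable is $\tau$. *)

theory Defs
  imports "HOL-Analysis.Analysis"
begin

text \<open>Derivatives are taken within the half line, so the one at the endpoint is one-sided and
  values of \<open>v\<close> at negative arguments play no role.\<close>

definition C1_on_half_line :: "(real \<Rightarrow> real) \<Rightarrow> bool" where
  "C1_on_half_line v \<longleftrightarrow>
     (\<exists>v'. continuous_on {0..} v' \<and>
           (\<forall>\<tau>\<ge>0. (v has_real_derivative v' \<tau>) (at \<tau> within {0..})))"

definition solves_ivp ::
  "(real \<times> real \<times> real \<times> real \<Rightarrow> real) \<Rightarrow> real \<Rightarrow> real \<Rightarrow> real \<Rightarrow> (real \<Rightarrow> real) \<Rightarrow> bool" where
  "solves_ivp f u t u0 v \<longleftrightarrow>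
     C1_on_half_line v \<and>
     (\<forall>\<tau>>0. (v has_real_derivative f (v \<tau>, \<tau>, u, t)) (at \<tau>)) \<and>
     v 0 = u0"

text \<open>The definite article in ``the solution'' is spelled out as existence together with
  uniqueness on the half line; outside it, the functions involved are arbitrary.
  Because solutions exist, at most one \<open>l\<close> can satisfy this predicate.\<close>

definition is_limit_slope ::
  "(real \<times> real \<times> real \<times> real \<Rightarrow> real) \<Rightarrow> real \<Rightarrow> real \<Rightarrow> real \<Rightarrow> bool" where
  "is_limit_slope f u t l \<longleftrightarrow>
     (\<forall>u0. \<exists>v. solves_ivp f u t u0 v \<and>
                (\<forall>w. solves_ivp f u t u0 w \<longrightarrow> (\<forall>\<tau>\<ge>0. w \<tau> = v \<tau>)) \<and>
                ((\<lambda>\<tau>. v \<tau> / \<tau>) \<longlongrightarrow> l) at_top)"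

end

theory Submission
  imports Defs
begin

text \<open>For frozen \<open>(u, t)\<close> the time-one map of the equation is a monotone lift of a circle map and
  \<open>\<lambda>\<close> is its translation number. Comparison with integer translates shows that any two solutions
  have displacements differing by at most 1 over the same period of time; hence for a solution \<open>v\<close> the
  sequence \<open>v n - v 0\<close> is additive up to an error of 1, which forces \<open>\<bar>v n - v 0 - n * \<lambda>\<bar> \<le> 1\<close>.
  This bound is uniform in \<open>(u, t)\<close>, so \<open>\<lambda>\<close> is a uniform limit of the functions \<open>v n / n\<close>, which
  depend continuously on \<open>(u, t)\<close> by a Gronwall estimate. Monotonicity in \<open>u\<close> is again the
  comparison principle.\<close>

section \<open>Global existence by Picard iteration in a weighted norm\<close>

lemma integral_has_real_derivative_half_line:
  fixes h :: "real \<Rightarrow> real"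
  assumes "continuous_on {0..} h" "T \<ge> 0"
  shows "((\<lambda>x. integral {0..x} h) has_real_derivative h T) (at T within {0..})"
proof -
  \<comment> \<open>The interval ends at \<open>T + 1\<close> so that \<open>T\<close> is not its
    right endpoint; near \<open>T\<close> it then coincides with the half line.\<close>
  have "((\<lambda>x. integral {0..x} h) has_real_derivative h T) (at T within {0..T + 1})"
    using assms by (intro integral_has_real_derivative continuous_on_subset[OF assms(1)]) auto
  moreover have "at T within {0..T + 1} = at T within {0..}"
    by (rule at_within_nhd[where S = "{..<T + 1}"]) auto
  ultimately show ?thesis by simp
qed

text \<open>Integrating \<open>exp (K * s)\<close> gains a factor \<open>1 / K\<close>, and the
  weight cancels the remaining exponential. This gain serves twice below: with \<open>C = M\<close>
  it keeps the Picard iterates bounded, and with \<open>C\<close> proportional to a distance it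
  makes the iteration contract.\<close>

lemma exp_weight_integral_bound:
  fixes h :: "real \<Rightarrow> real"
  assumes "continuous_on {0..} h" "T \<ge> 0" "K > 0" "C \<ge> 0"
    and le: "\<And>s. s \<ge> 0 \<Longrightarrow> \<bar>h s\<bar> \<le> C * exp (K * s)"
  shows "\<bar>exp (- K * T) * integral {0..T} h\<bar> \<le> C / K"
proof -
  have I: "((\<lambda>s. C * exp (K * s)) has_integral (C / K * exp (K * T) - C / K * exp (K * 0))) {0..T}"
    using assms by (intro fundamental_theorem_of_calculus)
      (auto simp flip: has_real_derivative_iff_has_vector_derivative intro!: derivative_eq_intros)
  have "norm (integral {0..T} h) \<le> integral {0..T} (\<lambda>s. C * exp (K * s))"
    using le I by (intro integral_norm_bound_integral integrable_continuous_interval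
        continuous_on_subset[OF assms(1)] continuous_intros) auto
  also have "\<dots> = C / K * exp (K * T) - C / K * exp (K * 0)"
    using I by (rule integral_unique)
  also have "\<dots> \<le> C / K * exp (K * T)"
    using assms by simp
  finally have "exp (- K * T) * \<bar>integral {0..T} h\<bar> \<le> exp (- K * T) * (C / K * exp (K * T))"
    by (intro mult_left_mono) auto
  also have "\<dots> = C / K"
    by (simp add: exp_minus)
  finally show ?thesis by (simp add: abs_mult)
qed

text \<open>Picard iteration contracts in the norm \<open>sup exp (- K * \<tau>) * \<bar>v \<tau>\<bar>\<close> for large \<open>K\<close>, so one
  application of Banach's theorem to \<open>w \<tau> = exp (- K * \<tau>) * v \<tau>\<close> yields a global solution.\<close>

lemma global_lipschitz_ivp:
  fixes g :: "real \<Rightarrow> real \<Rightarrow> real"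
  assumes cont: "continuous_on UNIV (\<lambda>(x, s). g x s)"
    and lip: "\<And>x y s. \<bar>g x s - g y s\<bar> \<le> L * \<bar>x - y\<bar>"
    and bound: "\<And>x s. \<bar>g x s\<bar> \<le> M"
  obtains v where "v 0 = x0"
    and "\<And>\<tau>. \<tau> \<ge> 0 \<Longrightarrow> (v has_real_derivative g (v \<tau>) \<tau>) (at \<tau> within {0..})"
proof -
  \<comment> \<open>Any \<open>K > L\<close> gives a contraction factor \<open>L / K\<close> below
    1; adding 1 also keeps \<open>K\<close> positive when \<open>L = 0\<close>.\<close>
  define K where "K = L + 1"
  have L: "L \<ge> 0" using lip[of 1 0 0] by simp
  have M: "M \<ge> 0" using bound[of 0 0] by simp
  have K: "K \<ge> 1" using L by (simp add: K_def)
  \<comment> \<open>Here \<open>w\<close> is the weighted unknown, and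
    \<open>exp (K * s) * w s\<close> recovers the solution. \<open>P w\<close> is the right-hand
    side of the integral equation; \<open>F w\<close> reapplies the weight and continues by the
    constant \<open>x0\<close> to negative times, which makes it a bounded continuous function on
    the whole line.\<close>
  define r where "r w s = g (exp (K * s) * w s) s" for w :: "real \<Rightarrow>\<^sub>C real" and s
  define P where "P w T = x0 + integral {0..T} (r w)" for w :: "real \<Rightarrow>\<^sub>C real" and T
  define F where "F w \<tau> = exp (- K * max 0 \<tau>) * P w (max 0 \<tau>)" for w \<tau>
  have r_cont: "continuous_on S (r w)" for w S
  proof -
    have "continuous_on S (\<lambda>s. (\<lambda>(x, s). g x s) (exp (K * s) * w s, s))"
      by (rule continuous_on_compose2[OF cont])
        (auto intro!: continuous_intros)
    thus ?thesis by (simp add: r_def)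
  qed
  have P_deriv: "(P w has_real_derivative r w T) (at T within {0..})" if "T \<ge> 0" for w T
    unfolding P_def
    using DERIV_add[OF DERIV_const integral_has_real_derivative_half_line[OF r_cont that]] by simp
  have P_cont: "continuous_on {0..} (P w)" for w
    by (rule DERIV_continuous_on) (use P_deriv in auto)
  have F_cont: "continuous_on UNIV (F w)" for w
    unfolding F_def by (intro continuous_intros continuous_on_compose2[OF P_cont]) auto
  have F_bounded: "\<bar>F w \<tau>\<bar> \<le> \<bar>x0\<bar> + M / K" for w \<tau>
  proof -
    have "\<bar>exp (- K * max 0 \<tau>) * integral {0..max 0 \<tau>} (r w)\<bar> \<le> M / K"
    proof (rule exp_weight_integral_bound[OF r_cont])
      fix s :: real assume "s \<ge> 0"
      have "\<bar>r w s\<bar> \<le> M * 1" using bound by (simp add: r_def)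
      also have "\<dots> \<le> M * exp (K * s)"
        using M K \<open>s \<ge> 0\<close> by (intro mult_left_mono) auto
      finally show "\<bar>r w s\<bar> \<le> M * exp (K * s)" .
    qed (use M K in auto)
    moreover have "\<bar>exp (- K * max 0 \<tau>) * x0\<bar> \<le> 1 * \<bar>x0\<bar>"
      using K unfolding abs_mult by (intro mult_right_mono) auto
    ultimately show ?thesis
      unfolding F_def P_def distrib_left by linarith
  qed
  have F_bcont: "F w \<in> bcontfun" for w
    using F_cont F_bounded by (intro bcontfun_normI) auto
  define \<Phi> where "\<Phi> w = Bcontfun (F w)" for w
  have \<Phi>_apply: "apply_bcontfun (\<Phi> w) = F w" for w
    using F_bcont by (simp add: \<Phi>_def Bcontfun_inverse)
  have "dist (\<Phi> w) (\<Phi> z) \<le> (L / K) * dist w z" for w z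
  proof (rule dist_bound)
    fix \<tau> :: real
    define T where "T = max 0 \<tau>"
    have "\<bar>exp (- K * T) * integral {0..T} (\<lambda>s. r w s - r z s)\<bar> \<le> (L * dist w z) / K"
    proof (rule exp_weight_integral_bound)
      fix s :: real assume "s \<ge> 0"
      have "\<bar>r w s - r z s\<bar> \<le> L * \<bar>exp (K * s) * w s - exp (K * s) * z s\<bar>"
        unfolding r_def by (rule lip)
      also have "\<dots> = L * exp (K * s) * dist (w s) (z s)"
        by (simp add: dist_real_def abs_mult flip: right_diff_distrib)
      also have "\<dots> \<le> L * exp (K * s) * dist w z"
        using L by (intro mult_left_mono dist_bounded) auto
      finally show "\<bar>r w s - r z s\<bar> \<le> L * dist w z * exp (K * s)" by (simp add: mult_ac)
    qed (use L K in \<open>auto simp: T_def intro!: continuous_intros r_cont\<close>)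
    moreover have "integral {0..T} (\<lambda>s. r w s - r z s) = P w T - P z T"
      unfolding P_def by (subst integral_diff) (auto intro!: integrable_continuous_interval r_cont)
    ultimately show "dist (\<Phi> w \<tau>) (\<Phi> z \<tau>) \<le> L / K * dist w z"
      by (simp add: \<Phi>_apply F_def T_def dist_real_def right_diff_distrib)
  qed
  moreover have "0 \<le> L / K" "L / K < 1" using L by (auto simp: K_def)
  ultimately obtain w where w: "\<Phi> w = w"
    using banach_fix_type[of "L / K" \<Phi>] by auto
  \<comment> \<open>With the weight removed, the fixed point equation says that \<open>P w\<close>
    solves the integral equation.\<close>
  have *: "exp (K * \<tau>) * w \<tau> = P w \<tau>" if "\<tau> \<ge> 0" for \<tau>
  proof -
    have "w \<tau> = F w \<tau>" using w \<Phi>_apply by metis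
    thus ?thesis using that by (simp add: F_def exp_minus)
  qed
  show ?thesis
  proof (rule that[of "P w"])
    show "P w 0 = x0" by (simp add: P_def)
    show "(P w has_real_derivative g (P w \<tau>) \<tau>) (at \<tau> within {0..})" if "\<tau> \<ge> 0" for \<tau>
      using P_deriv[OF that, of w] *[OF that] by (simp add: r_def)
  qed
qed

section \<open>Comparison of solutions, and their translates\<close>

text \<open>If \<open>h b > 0\<close>, follow \<open>h\<close> from the last time \<open>a\<close>
  before \<open>b\<close> with \<open>h a \<le> 0\<close>. On the stretch after \<open>a\<close> the
  function is positive, so the differential inequality applies and
  \<open>exp (- K * s) * h s\<close> cannot increase, a contradiction. Asking for the inequality
  only where \<open>h\<close> is positive is what allows its use for ordering solutions.\<close>

lemma one_sided_gronwall:
  fixes h :: "real \<Rightarrow> real"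
  assumes cont: "continuous_on {0..} h" and "h 0 \<le> 0"
    and deriv: "\<And>s. s > 0 \<Longrightarrow> (h has_real_derivative h' s) (at s)"
    and le: "\<And>s. s > 0 \<Longrightarrow> h s > 0 \<Longrightarrow> h' s \<le> K * h s"
    and "b \<ge> 0"
  shows "h b \<le> 0"
proof (rule ccontr)
  assume "\<not> h b \<le> 0"
  \<comment> \<open>The supremum of this set is the last such time; closedness ensures that it is
    attained.\<close>
  define A where "A = {0..b} \<inter> h -` {..0}"
  have "closed A"
    unfolding A_def
    by (intro continuous_closed_preimage continuous_on_subset[OF cont]) auto
  moreover have "0 \<in> A" using assms by (auto simp: A_def)
  moreover have "bdd_above A" by (auto simp: A_def)
  ultimately have a: "Sup A \<in> A" by (intro closed_contains_Sup) auto
  define a where "a = Sup A"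
  have a0: "a \<ge> 0" "a < b" "h a \<le> 0"
    using a \<open>\<not> h b \<le> 0\<close> by (auto simp: A_def a_def less_le)
  have pos: "h s > 0" if "a < s" "s \<le> b" for s
  proof (rule ccontr)
    assume "\<not> h s > 0"
    hence "s \<in> A" using that a0 by (auto simp: A_def)
    hence "s \<le> a" unfolding a_def using \<open>bdd_above A\<close> by (rule cSup_upper)
    thus False using that by simp
  qed
  have "exp (- K * b) * h b \<le> exp (- K * a) * h a"
  proof (rule DERIV_nonpos_imp_decreasing_open[where f = "\<lambda>s. exp (- K * s) * h s"])
    fix s assume s: "a < s" "s < b"
    have "((\<lambda>s. exp (- K * s) * h s) has_real_derivative exp (- K * s) * (h' s - K * h s)) (at s)"
      using s a0 by (auto intro!: derivative_eq_intros deriv simp: algebra_simps)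
    moreover have "exp (- K * s) * (h' s - K * h s) \<le> 0"
      using le[of s] pos[of s] s a0 by (intro mult_nonneg_nonpos) auto
    ultimately show "\<exists>y. ((\<lambda>s. exp (- K * s) * h s) has_real_derivative y) (at s) \<and> y \<le> 0"
      by blast
  qed (use a0 in \<open>auto intro!: continuous_intros continuous_on_subset[OF cont]\<close>)
  also have "\<dots> \<le> 0" using a0 by (simp add: mult_nonneg_nonpos)
  finally show False using \<open>\<not> h b \<le> 0\<close> by (simp add: mult_le_0_iff)
qed

text \<open>No initial value is prescribed, so translates of solutions in space and time fit the
  same predicate. At 0 continuity is enough for the Gronwall argument.\<close>

definition half_line_solution :: "(real \<Rightarrow> real \<Rightarrow> real) \<Rightarrow> (real \<Rightarrow> real) \<Rightarrow> bool" where
  "half_line_solution g v \<longleftrightarrow>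
     continuous_on {0..} v \<and> (\<forall>\<tau>>0. (v has_real_derivative g (v \<tau>) \<tau>) (at \<tau>))"

text \<open>The case \<open>e = 0\<close> is the comparison principle, which yields ordering,
  uniqueness and monotonicity in the parameter. The case of general \<open>e\<close>, used in both
  directions, yields continuous dependence on parameters.\<close>

lemma half_line_solution_comparison:
  fixes v w :: "real \<Rightarrow> real"
  assumes v: "half_line_solution g1 v" and w: "half_line_solution g2 w"
    and lip: "\<And>x y s. \<bar>g1 x s - g1 y s\<bar> \<le> L * \<bar>x - y\<bar>"
    and le: "\<And>x s. g1 x s \<le> g2 x s + e"
    and "e \<ge> 0" "v 0 \<le> w 0" "\<tau> \<ge> 0"
  shows "v \<tau> - w \<tau> \<le> e * \<tau> * exp (L * \<tau>)"
proof -
  have L: "L \<ge> 0" using lip[of 1 0 0] by simp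
  define h where "h s = v s - w s - e * s * exp (L * s)" for s
  define h' where "h' s = g1 (v s) s - g2 (w s) s - e * exp (L * s) - e * s * (L * exp (L * s))" for s
  have "h \<tau> \<le> 0"
  proof (rule one_sided_gronwall[where h = h and h' = h' and K = L])
    show "continuous_on {0..} h"
      using v w unfolding h_def half_line_solution_def by (auto intro!: continuous_intros)
    show "h 0 \<le> 0" using assms by (simp add: h_def)
    show "(h has_real_derivative h' s) (at s)" if "s > 0" for s
      unfolding h_def h'_def using v w that
      by (auto intro!: derivative_eq_intros simp: half_line_solution_def algebra_simps)
    show "h' s \<le> L * h s" if "s > 0" "h s > 0" for s
    proof -
      \<comment> \<open>Where \<open>h\<close> is positive, \<open>v\<close> lies above
        \<open>w\<close>, so the Lipschitz bound holds without absolute values. The extra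
        \<open>e\<close> is then absorbed by the term \<open>e * exp (L * s)\<close> in
        \<open>h'\<close>.\<close>
      have "0 \<le> e * s * exp (L * s)" using assms that by simp
      hence "v s > w s" using that(2) by (simp add: h_def)
      hence "g1 (v s) s \<le> g2 (w s) s + e + L * (v s - w s)"
        using lip[of "v s" s "w s"] le[of "w s" s] by simp
      moreover have "e \<le> e * exp (L * s)"
        using assms L that by (simp add: mult_le_cancel_left1)
      ultimately show ?thesis by (simp add: h_def h'_def algebra_simps)
    qed
  qed fact
  thus ?thesis by (simp add: h_def)
qed


text \<open>One hypothesis covers both translates in use: \<open>d = 0\<close> with integer
  \<open>c\<close> shifts values, and \<open>c = 0\<close> with integer \<open>d\<close> shifts
  time.\<close>

lemma half_line_solution_shift:
  fixes v :: "real \<Rightarrow> real"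
  assumes v: "half_line_solution g v"
    and periodic: "\<And>x s. g (x + c) s = g x (s + d)" and "d \<ge> 0"
  shows "half_line_solution g (\<lambda>s. v (s + d) + c)"
  unfolding half_line_solution_def
proof (intro conjI allI impI)
  show "continuous_on {0..} (\<lambda>s. v (s + d) + c)"
    using v \<open>d \<ge> 0\<close> unfolding half_line_solution_def
    by (auto intro!: continuous_intros continuous_on_compose2[of "{0..}" v])
  fix s :: real assume "s > 0"
  hence "(v has_real_derivative g (v (s + d)) (s + d)) (at (s + d))"
    using v \<open>d \<ge> 0\<close> by (simp add: half_line_solution_def)
  hence "((\<lambda>s. v (s + d) + c) has_real_derivative g (v (s + d)) (s + d) + 0) (at s)"
    by (intro DERIV_add DERIV_const) (simp add: DERIV_shift)
  thus "((\<lambda>s. v (s + d) + c) has_real_derivative g (v (s + d) + c) s) (at s)"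
    by (simp add: periodic)
qed

section \<open>Almost additive sequences\<close>

text \<open>Both \<open>m * a n\<close> and \<open>n * a m\<close> are close to
  \<open>a (m * n)\<close>, hence to each other. Dividing by \<open>m * n\<close> shows that the
  averages \<open>a n / n\<close> form a Cauchy sequence with an explicit rate.\<close>

lemma almost_additive_slope:
  fixes a :: "nat \<Rightarrow> real"
  assumes "\<And>m n. \<bar>a (m + n) - a m - a n\<bar> \<le> C"
  shows "\<exists>l::real. \<forall>n. \<bar>a n - n * l\<bar> \<le> C"
proof -
  have mult: "\<bar>a (Suc m * n) - Suc m * a n\<bar> \<le> m * C" for m n
  proof (induction m)
    case (Suc m)
    have "\<bar>a (n + Suc m * n) - a n - a (Suc m * n)\<bar> \<le> C" by (rule assms)
    with Suc show ?case by (simp add: algebra_simps)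
  qed simp
  have "C \<ge> 0" using assms[of 0 0] by linarith
  have mult': "\<bar>a (m * n) - m * a n\<bar> \<le> m * C" if "m > 0" for m n
    using mult[of "m - 1" n] that \<open>C \<ge> 0\<close> by (simp add: of_nat_diff algebra_simps)
  have swap: "\<bar>n * a m - m * a n\<bar> \<le> (m + n) * C" if "m > 0" "n > 0" for m n :: nat
    using mult'[OF that(1), of n] mult'[OF that(2), of m]
    by (simp add: mult.commute[of n m] distrib_right)
  have diff: "\<bar>a m / m - a n / n\<bar> \<le> C / m + C / n" if "m > 0" "n > 0" for m n :: nat
    using swap[OF that] that by (simp add: field_simps abs_le_iff)
  have small: "(\<lambda>n. C / real n) \<longlonglongrightarrow> 0"
    by (rule lim_const_over_n)
  have "Cauchy (\<lambda>n. a n / n)"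
  proof (rule metric_CauchyI)
    fix e :: real assume "e > 0"
    hence "\<forall>\<^sub>F n in sequentially. C / n < e / 2 \<and> n > 0"
      by (intro eventually_conj order_tendstoD(2)[OF small] eventually_gt_at_top) auto
    then obtain N where N: "\<And>n. n \<ge> N \<Longrightarrow> C / real n < e / 2 \<and> n > 0"
      unfolding eventually_sequentially by blast
    show "\<exists>N. \<forall>m\<ge>N. \<forall>n\<ge>N. dist (a m / m) (a n / n) < e"
    proof (intro exI allI impI)
      fix m n assume "N \<le> m" "N \<le> n"
      thus "dist (a m / m) (a n / n) < e"
        using N[of m] N[of n] diff[of m n] unfolding dist_real_def by linarith
    qed
  qed
  then obtain l where l: "(\<lambda>n. a n / n) \<longlonglongrightarrow> l"
    using Cauchy_convergent convergent_def by blast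
  have "\<bar>a n - n * l\<bar> \<le> C" for n
  proof (cases "n = 0")
    case True
    thus ?thesis using assms[of 0 0] by simp
  next
    case False
    \<comment> \<open>Letting \<open>m\<close> tend to infinity in \<open>diff\<close> removes the
      term \<open>C / m\<close>, so multiplying by \<open>n\<close> gives back the constant
      \<open>C\<close> without loss.\<close>
    have "\<bar>l - a n / n\<bar> \<le> 0 + C / n"
    proof (rule tendsto_le[OF sequentially_bot])
      show "(\<lambda>m. \<bar>a m / m - a n / n\<bar>) \<longlonglongrightarrow> \<bar>l - a n / n\<bar>"
        by (intro tendsto_intros l)
      show "(\<lambda>m. C / real m + C / n) \<longlonglongrightarrow> 0 + C / n"
        by (intro tendsto_intros small)
      show "\<forall>\<^sub>F m in sequentially. \<bar>a m / m - a n / n\<bar> \<le> C / m + C / n"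
        using eventually_gt_at_top[of 0] by eventually_elim (use diff False in auto)
    qed
    thus ?thesis using False by (simp add: field_simps abs_le_iff)
  qed
  thus ?thesis by blast
qed

lemma bounded_over_at_top:
  fixes h :: "real \<Rightarrow> real"
  assumes "\<And>s. s \<ge> 0 \<Longrightarrow> \<bar>h s\<bar> \<le> C"
  shows "((\<lambda>s. h s / s) \<longlongrightarrow> 0) at_top"
proof (rule Lim_null_comparison)
  show "\<forall>\<^sub>F s in at_top. norm (h s / s) \<le> C / s"
    using eventually_gt_at_top[of 0]
    by eventually_elim (use assms in \<open>auto intro!: divide_right_mono\<close>)
  show "((\<lambda>s. C / s) \<longlongrightarrow> 0) at_top"
    by (rule tendsto_divide_0[OF tendsto_const filterlim_at_top_imp_at_infinity[OF filterlim_ident]])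
qed

section \<open>The translation number of a periodic equation\<close>

locale periodic_ode =
  fixes g :: "real \<Rightarrow> real \<Rightarrow> real" and L M :: real
  assumes lip: "\<bar>g x s - g y s\<bar> \<le> L * \<bar>x - y\<bar>"
    and bound: "\<bar>g x s\<bar> \<le> M"
    and periodic: "g (x + of_int l) (s + of_int k) = g x s"
begin

lemma solution_mono:
  fixes v w :: "real \<Rightarrow> real"
  assumes "half_line_solution g v" "half_line_solution g w" "v 0 \<le> w 0" "\<tau> \<ge> 0"
  shows "v \<tau> \<le> w \<tau>"
  using half_line_solution_comparison[OF assms(1,2) lip, of 0] assms(3,4) by simp

text \<open>Translates of a solution by consecutive integers enclose any other solution.\<close>

lemma displacement_spread:
  fixes v w :: "real \<Rightarrow> real"
  assumes v: "half_line_solution g v" and w: "half_line_solution g w" and "\<tau> \<ge> 0"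
  shows "\<bar>(w \<tau> - w 0) - (v \<tau> - v 0)\<bar> \<le> 1"
proof -
  define m where "m = \<lfloor>w 0 - v 0\<rfloor>"
  have m: "v 0 + of_int m \<le> w 0" "w 0 \<le> v 0 + of_int (m + 1)"
    unfolding m_def by linarith+
  have shift: "half_line_solution g (\<lambda>s. v (s + 0) + of_int k)" for k
    using periodic[of _ k _ 0] by (intro half_line_solution_shift[OF v]) auto
  have "v \<tau> + of_int m \<le> w \<tau>" "w \<tau> \<le> v \<tau> + of_int (m + 1)"
    using solution_mono[OF shift w, of m \<tau>] solution_mono[OF w shift, of "m + 1" \<tau>] m \<open>\<tau> \<ge> 0\<close>
    by simp_all
  thus ?thesis using m by (simp add: abs_le_iff)
qed

lemma solution_increment_bound:
  fixes v :: "real \<Rightarrow> real"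
  assumes v: "half_line_solution g v" and "0 \<le> a" "a \<le> b"
  shows "\<bar>v b - v a\<bar> \<le> M * (b - a)"
proof (cases "a = b")
  case False
  hence "a < b" using assms by simp
  moreover have "continuous_on {a..b} v"
    using v \<open>0 \<le> a\<close> by (auto simp: half_line_solution_def intro: continuous_on_subset)
  moreover have deriv: "(v has_real_derivative g (v z) z) (at z)" if "a < z" for z
    using v \<open>0 \<le> a\<close> that by (simp add: half_line_solution_def)
  ultimately obtain l z where z: "a < z" "(v has_real_derivative l) (at z)"
    "v b - v a = (b - a) * l"
    using MVT[of a b v] by (metis real_differentiable_def)
  hence "v b - v a = (b - a) * g (v z) z"
    using DERIV_unique[OF z(2) deriv[OF z(1)]] by simp
  thus ?thesis using bound[of "v z" z] assms
    by (simp add: abs_mult mult.commute[of M] mult_left_mono)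
qed simp

text \<open>By periodicity in time, restarting a solution at time \<open>m\<close> gives another
  solution of the same equation. \<open>displacement_spread\<close> therefore makes
  \<open>v n - v 0\<close> additive up to 1. Passing from integers to real times costs only a
  bounded error, since the speed is at most \<open>M\<close>.\<close>

lemma solution_slope:
  fixes v :: "real \<Rightarrow> real"
  assumes v: "half_line_solution g v"
  obtains l :: real where "((\<lambda>\<tau>. v \<tau> / \<tau>) \<longlongrightarrow> l) at_top"
    and "\<And>n::nat. \<bar>v n - v 0 - n * l\<bar> \<le> 1"
proof -
  have "\<bar>(v (real (m + n)) - v 0) - (v m - v 0) - (v n - v 0)\<bar> \<le> 1" for m n :: nat
  proof -
    have "half_line_solution g (\<lambda>s. v (s + real m) + 0)"
      using periodic[of _ 0 _ "int m"] by (intro half_line_solution_shift[OF v]) auto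
    from displacement_spread[OF v this, of n] show ?thesis
      by (simp add: add.commute algebra_simps)
  qed
  from almost_additive_slope[of "\<lambda>n. v (real n) - v 0", OF this]
  obtain l where l: "\<And>n::nat. \<bar>v n - v 0 - n * l\<bar> \<le> 1" by blast
  \<comment> \<open>Rounding the time down to an integer contributes \<open>M\<close> from the
    motion of \<open>v\<close> and the absolute value of \<open>l\<close> from the linear term; the
    rest is the bound at integers.\<close>
  have "\<bar>v \<tau> - \<tau> * l\<bar> \<le> \<bar>v 0\<bar> + 1 + M + \<bar>l\<bar>" if "\<tau> \<ge> 0" for \<tau>
  proof -
    define n where "n = nat \<lfloor>\<tau>\<rfloor>"
    have n: "real n \<le> \<tau>" "\<tau> - n \<le> 1" using that unfolding n_def by linarith+
    have "M \<ge> 0" using bound[of 0 0] by linarith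
    hence "\<bar>v \<tau> - v n\<bar> \<le> M"
      using solution_increment_bound[OF v _ n(1)] mult_left_mono[OF n(2), of M] by simp
    moreover have "\<bar>\<tau> * l - n * l\<bar> \<le> 1 * \<bar>l\<bar>"
      unfolding left_diff_distrib[symmetric] abs_mult using n by (intro mult_right_mono) auto
    ultimately show ?thesis using l[of n] by linarith
  qed
  from bounded_over_at_top[of "\<lambda>\<tau>. v \<tau> - \<tau> * l", OF this]
  have "((\<lambda>\<tau>. (v \<tau> - \<tau> * l) / \<tau> + l) \<longlongrightarrow> 0 + l) at_top"
    by (intro tendsto_add tendsto_const)
  moreover have "\<forall>\<^sub>F \<tau> in at_top. (v \<tau> - \<tau> * l) / \<tau> + l = v \<tau> / \<tau>"
    using eventually_gt_at_top[of 0] by eventually_elim (simp add: field_simps)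
  ultimately have "((\<lambda>\<tau>. v \<tau> / \<tau>) \<longlongrightarrow> l) at_top"
    using tendsto_cong by fastforce
  thus ?thesis using l that by blast
qed

lemma slope_deviation:
  fixes n :: nat and v :: "real \<Rightarrow> real" and l :: real
  assumes "half_line_solution g v" "((\<lambda>\<tau>. v \<tau> / \<tau>) \<longlongrightarrow> l) at_top"
  shows "\<bar>v (real n) - v 0 - real n * l\<bar> \<le> 1"
  using solution_slope[OF assms(1)] tendsto_unique[OF trivial_limit_at_top_linorder assms(2)]
  by metis

lemma slope_independent_of_start:
  fixes v w :: "real \<Rightarrow> real"
  assumes v: "half_line_solution g v" and w: "half_line_solution g w"
    and l: "((\<lambda>\<tau>. v \<tau> / \<tau>) \<longlongrightarrow> l) at_top"
  shows "((\<lambda>\<tau>. w \<tau> / \<tau>) \<longlongrightarrow> l) at_top"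
proof -
  have "((\<lambda>\<tau>. (w \<tau> - v \<tau>) / \<tau>) \<longlongrightarrow> 0) at_top"
  proof (rule bounded_over_at_top)
    show "\<bar>w \<tau> - v \<tau>\<bar> \<le> 1 + \<bar>w 0 - v 0\<bar>" if "\<tau> \<ge> 0" for \<tau>
      using displacement_spread[OF v w that] by linarith
  qed
  from tendsto_add[OF this l] show ?thesis by (simp add: diff_divide_distrib)
qed

end

section \<open>Existence, continuity and monotonicity of the limit slope\<close>

lemma half_line_solution_if_solves_ivp:
  assumes "solves_ivp f u t u0 v"
  shows "half_line_solution (\<lambda>x s. f (x, s, u, t)) v"
  using assms unfolding solves_ivp_def C1_on_half_line_def half_line_solution_def
  by (auto intro: DERIV_continuous_on)

lemma solves_ivp_exists:
  assumes "L-lipschitz_on UNIV f" "bounded (range f)"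
  shows "\<exists>v. solves_ivp f u t u0 v"
proof -
  obtain M where M: "\<And>p. \<bar>f p\<bar> \<le> M"
    using assms(2) by (auto simp: bounded_iff)
  have f_cont: "continuous_on UNIV f"
    using assms(1) by (rule lipschitz_on_continuous_on)
  obtain v where v: "v 0 = u0"
    "\<And>\<tau>. \<tau> \<ge> 0 \<Longrightarrow> (v has_real_derivative f (v \<tau>, \<tau>, u, t)) (at \<tau> within {0..})"
  proof (rule global_lipschitz_ivp[of "\<lambda>x s. f (x, s, u, t)" L M u0])
    show "continuous_on UNIV (\<lambda>(x, s). f (x, s, u, t))"
      unfolding case_prod_beta
      by (rule continuous_on_compose2[OF f_cont]) (auto intro!: continuous_intros)
    show "\<bar>f (x, s, u, t) - f (y, s, u, t)\<bar> \<le> L * \<bar>x - y\<bar>" for x y s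
      using lipschitz_onD[OF assms(1), of "(x, s, u, t)" "(y, s, u, t)"]
      by (simp add: dist_Pair_Pair dist_real_def)
  qed (use M in auto)
  have "C1_on_half_line v"
    unfolding C1_on_half_line_def
  proof (intro exI conjI)
    have "continuous_on {0..} v"
      by (rule DERIV_continuous_on) (use v(2) in auto)
    thus "continuous_on {0..} (\<lambda>\<tau>. f (v \<tau>, \<tau>, u, t))"
      by (intro continuous_on_compose2[OF f_cont] continuous_intros) auto
  qed (use v(2) in auto)
  moreover have "(v has_real_derivative f (v \<tau>, \<tau>, u, t)) (at \<tau>)" if "\<tau> > 0" for \<tau>
    using v(2)[of \<tau>] that at_within_interior[of \<tau> "{0..}"] by simp
  ultimately show ?thesis using v(1) by (auto simp: solves_ivp_def)
qed

theorem proposition1p1: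
  fixes f :: "real \<times> real \<times> real \<times> real \<Rightarrow> real"
  assumes A1_bounded: "bounded (range f)"
    and A1_lipschitz: "\<exists>L. L-lipschitz_on UNIV f"
    and A2: "\<And>v \<tau> u t (l::int) (k::int). f (v + of_int l, \<tau> + of_int k, u, t) = f (v, \<tau>, u, t)"
    and A3: "\<And>v \<tau> t. antimono (\<lambda>u. f (v, \<tau>, u, t))"
  shows "(\<forall>u t. \<exists>l. is_limit_slope f u t l) \<and>
         (\<forall>fbar :: real \<times> real \<Rightarrow> real.
            (\<forall>u t. is_limit_slope f u t (fbar (u, t))) \<longrightarrow>
              continuous_on UNIV fbar \<and>
              (\<forall>t\<ge>0. antimono (\<lambda>u. fbar (u, t))))"
proof -
  obtain L where L: "L-lipschitz_on UNIV f" using A1_lipschitz by blast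
  obtain M where M: "\<And>p. \<bar>f p\<bar> \<le> M"
    using A1_bounded by (auto simp: bounded_iff)
  define g where "g u t = (\<lambda>x s. f (x, s, u, t))" for u t
  have lip: "\<bar>g u t x s - g u' t' y s'\<bar> \<le> L * dist (x, s, u, t) (y, s', u', t')"
    for u t x s u' t' y s' :: real
    using lipschitz_onD[OF L, of "(x, s, u, t)" "(y, s', u', t')"]
    by (simp add: g_def dist_real_def)
  have lip_x: "\<bar>g u t x s - g u t y s\<bar> \<le> L * \<bar>x - y\<bar>" for u t x y s :: real
    using lip[of u t x s u t y s] by (simp add: dist_Pair_Pair dist_real_def)
  have ode: "periodic_ode (g u t) L M" for u t
    by unfold_locales (use lip_x M A2 in \<open>auto simp: g_def\<close>)
  have sol: "half_line_solution (g u t) v" if "solves_ivp f u t u0 v" for u t u0 v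
    using half_line_solution_if_solves_ivp[OF that] by (simp add: g_def)
  have start: "v 0 = u0" if "solves_ivp f u t u0 v" for u t u0 v
    using that by (simp add: solves_ivp_def)
  have "\<exists>l. is_limit_slope f u t l" for u t
  proof -
    interpret periodic_ode "g u t" L M by (rule ode)
    \<comment> \<open>The slope must be chosen before \<open>u0\<close>. It is read off from the
      solution starting at 0 and then transferred to every other start.\<close>
    obtain v0 where v0: "solves_ivp f u t 0 v0"
      using solves_ivp_exists[OF L A1_bounded] by blast
    obtain l where l: "((\<lambda>\<tau>. v0 \<tau> / \<tau>) \<longlongrightarrow> l) at_top"
      using solution_slope[OF sol[OF v0]] by blast
    have "is_limit_slope f u t l"
      unfolding is_limit_slope_def
    proof
      fix u0
      obtain v where v: "solves_ivp f u t u0 v"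
        using solves_ivp_exists[OF L A1_bounded] by blast
      have "w \<tau> = v \<tau>" if w: "solves_ivp f u t u0 w" and "\<tau> \<ge> 0" for w \<tau>
        using solution_mono[OF sol[OF v] sol[OF w]] solution_mono[OF sol[OF w] sol[OF v]]
          start[OF v] start[OF w] that by (intro antisym) auto
      moreover have "((\<lambda>\<tau>. v \<tau> / \<tau>) \<longlongrightarrow> l) at_top"
        using slope_independent_of_start[OF sol[OF v0] sol[OF v] l] .
      ultimately show "\<exists>v. solves_ivp f u t u0 v \<and>
          (\<forall>w. solves_ivp f u t u0 w \<longrightarrow> (\<forall>\<tau>\<ge>0. w \<tau> = v \<tau>)) \<and>
          ((\<lambda>\<tau>. v \<tau> / \<tau>) \<longlongrightarrow> l) at_top"
        using v by blast
    qed
    thus ?thesis ..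
  qed
  moreover have "continuous_on UNIV fbar \<and> (\<forall>t\<ge>0. antimono (\<lambda>u. fbar (u, t)))"
    if fbar: "\<forall>u t. is_limit_slope f u t (fbar (u, t))" for fbar
  proof -
    have "\<forall>u t. \<exists>v. solves_ivp f u t 0 v \<and> ((\<lambda>\<tau>. v \<tau> / \<tau>) \<longlongrightarrow> fbar (u, t)) at_top"
      using fbar unfolding is_limit_slope_def by blast
    then obtain V where V: "\<And>u t. solves_ivp f u t 0 (V u t)"
      and slope: "\<And>u t. ((\<lambda>\<tau>. V u t \<tau> / \<tau>) \<longlongrightarrow> fbar (u, t)) at_top"
      by metis
    note V_sol = sol[OF V]
    have compare: "V u t \<tau> - V u' t' \<tau> \<le> e * \<tau> * exp (L * \<tau>)"
      if "\<And>x s. g u t x s \<le> g u' t' x s + e" "e \<ge> 0" "\<tau> \<ge> 0" for u t u' t' e \<tau>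
      using half_line_solution_comparison[OF V_sol V_sol lip_x that(1,2)] start[OF V] that(3)
      by simp
    \<comment> \<open>For \<open>n = 0\<close> division by zero makes the function constantly
      0.\<close>
    have V_cont: "continuous_on UNIV (\<lambda>p. V (fst p) (snd p) n / n)" for n :: nat
    proof (cases "n = 0")
      case False
      \<comment> \<open>A Lipschitz constant in the parameters at time \<open>n\<close>. Its growth
        with \<open>n\<close> is harmless: each approximant only has to be continuous, and
        uniformity of the limit comes from \<open>slope_deviation\<close>.\<close>
      define C where "C = L * n * exp (L * n)"
      have *: "V u t n - V u' t' n \<le> C * dist (u, t) (u', t')" for u t u' t'
      proof -
        have "V u t n - V u' t' n \<le> (L * dist (u, t) (u', t')) * n * exp (L * n)"
        proof (rule compare)
          fix x s :: real
          have "dist (x, s, u, t) (x, s, u', t') = dist (u, t) (u', t')"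
            by (simp add: dist_Pair_Pair)
          thus "g u t x s \<le> g u' t' x s + L * dist (u, t) (u', t')"
            using lip[of u t x s u' t' x s] by simp
        qed (use lipschitz_on_nonneg[OF L] in auto)
        thus ?thesis by (simp add: C_def mult_ac)
      qed
      have "C-lipschitz_on UNIV (\<lambda>p. V (fst p) (snd p) n)"
      proof (rule lipschitz_onI)
        show "dist (V (fst p) (snd p) n) (V (fst q) (snd q) n) \<le> C * dist p q" for p q
          using *[of "fst p" "snd p" "fst q" "snd q"] *[of "fst q" "snd q" "fst p" "snd p"]
          by (simp add: dist_real_def abs_le_iff dist_commute)
        show "C \<ge> 0" using lipschitz_on_nonneg[OF L] by (simp add: C_def)
      qed
      thus ?thesis
        using False by (intro continuous_intros lipschitz_on_continuous_on) auto
    qed simp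
    have "continuous_on UNIV fbar"
    proof (rule uniform_limit_theorem)
      show "uniform_limit UNIV (\<lambda>n p. V (fst p) (snd p) (real n) / real n) fbar sequentially"
      proof (rule uniform_limitI)
        fix e :: real assume "e > 0"
        have "\<forall>\<^sub>F n in sequentially. 1 / real n < e"
          using order_tendstoD(2)[OF lim_const_over_n \<open>e > 0\<close>] .
        thus "\<forall>\<^sub>F n in sequentially. \<forall>p\<in>UNIV.
            dist (V (fst p) (snd p) (real n) / real n) (fbar p) < e"
          using eventually_gt_at_top[of 0]
        proof eventually_elim
          case (elim n)
          have "dist (V u t n / n) (fbar (u, t)) \<le> 1 / n" for u t
            using periodic_ode.slope_deviation[OF ode V_sol slope[of u t], of n]
              start[OF V] elim
            by (simp add: dist_real_def field_simps abs_le_iff)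
          thus ?case using elim by (metis UNIV_I le_less_trans prod.collapse)
        qed
      qed
    qed (use V_cont in auto)
    moreover have "antimono (\<lambda>u. fbar (u, t))" for t
    proof (rule antimonoI)
      fix u u' :: real assume "u \<le> u'"
      \<comment> \<open>By \<open>A3\<close> the larger parameter has the smaller right-hand side,
        so comparison with error 0 orders the two solutions from the common start 0.\<close>
      have "V u' t \<tau> \<le> V u t \<tau>" if "\<tau> \<ge> 0" for \<tau>
        using compare[of u' t u t 0 \<tau>] antimonoD[OF A3 \<open>u \<le> u'\<close>] that
        by (simp add: g_def)
      hence "\<forall>\<^sub>F \<tau> in at_top. V u' t \<tau> / \<tau> \<le> V u t \<tau> / \<tau>"
        by (intro eventually_mono[OF eventually_gt_at_top[of 0]]) (simp add: divide_right_mono)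
      thus "fbar (u', t) \<le> fbar (u, t)"
        using tendsto_le[OF trivial_limit_at_top_linorder slope slope] by blast
    qed
    ultimately show ?thesis by blast
  qed
  ultimately show ?thesis by blast
qed

end
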